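(* Let $\mathcal{S}=(V,\Sigma,\delta)$ be a nondeterministic fuzzy transition system, $k,k_1,k_2\in\mathbb{N}$ and $\alpha,\alpha_1,\alpha_2\in[0,1]$. Then: (1) If $k_1\ge k_2$ and $\alpha_1\ge\alpha_2$, then $\approx_{k_1}^{\alpha_1}\subseteq\approx_{k_2}^{\alpha_2}$. (2) $I_V=\{(u,u): u\in V\}$ is a $k$-limited $\alpha$-bisimulation for any $k\in\mathbb{N}$ and $\alpha\in[0,1]$. (3) If $R_i$ is a $k_i$-limited $\alpha_i$-bisimulation, $i=1,2$, then $R_1\cap R_2$ is a $(k_1\wedge k_2)$-limited $(\alpha_1\vee\alpha_2)$-bisimulation and is also a $(k_1\vee k_2)$-limited $(\alpha_1\wedge\alpha_2)$-bisimulation, and $R_1\cup R_2$ is a $(k_1\wedge k_2)$-limited $(\alpha_1\wedge\alpha_2)$-bisimulation. (4) If $R$ is a $k$-limited $\alpha$-bisimulation, then so is $R^{-1}$. (5) If $R_i$ is a $k_i$-limited $\alpha_i$-bisimulation, $i=1,2$, then $R_1\circ R_2$ is a $(k_1\wedge k_2)$-limited $(\alpha_1\otimes\alpha_2)$-bisimulation.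
   Context: Let $\otimes$ be a fixed left-continuous $t$-norm on $[0,1]$: commutative, associative, increasing, with neutral element $1$, and $r\otimes\bigvee_i r_i=\bigvee_i (r\otimes r_i)$. Its residuum is $t\rightarrow r=\bigvee\{s\in[0,1]: s\otimes t\le r\}$. $\wedge,\vee$ are min, max (and $\bigwedge,\bigvee$ inf, sup); $\mathbb{N}$ contains $0$. $V$ is a nonempty finite set; $\mathcal{R}(V)$ is the set of fuzzy subsets of $V$ (maps $V\to[0,1]$), also called distributions. For $p\in\mathcal{R}(V)$ and $X\subseteq V$, $p(X)=\bigvee_{x\in X}p(x)$ (with $p(\emptyset)=0$). A nondeterministic fuzzy transition system (NFTS) is a triple $\mathcal{S}=(V,\Sigma,\delta)$ with $\Sigma$ a set of labels and $\delta\subseteq V\times\Sigma\times\mathcal{R}(V)$; $\delta(u,\tau)=\{p:(u,\tau,p)\in\delta\}$, and $u\overset{\tau}{\longrightarrow}p$ means $p\in\delta(u,\tau)$. For $R\subseteq V\times V$: $\overrightarrow{R}_u=\{v:(u,v)\in R\}$, $\overleftarrow{R}_u=\{v:(v,u)\in R\}$, and $\widetilde{S}(p,q,R)=\bigwedge_{u\in V}\big((p(u)\rightarrow q(\overrightarrow{R}_u))\wedge(q(u)\rightarrow p(\overleftarrow{R}_u))\big)$. The lifted relation is $R_\alpha^{\dagger}=\{(p,q)\in\mathcal{R}(V)\times\mathcal{R}(V):\widetilde{S}(p,q,R)\ge\alpha\}$. $R^{-1}$ is the converse relation and $R_1\circ R_2=\{(u,v):\exists w,\ (u,w)\in R_1,\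 (w,v)\in R_2\}$. $k$-limited $\alpha$-bisimilarity $\approx_k^{\alpha}\subseteq V\times V$: $u\approx_0^\alpha v$ for all $u,v$; and $u\approx_{i+1}^\alpha v$ iff for each $\tau\in\Sigma$: $u\overset{\tau}{\longrightarrow}p$ implies there is $v\overset{\tau}{\longrightarrow}q$ with $(p,q)\in(\approx_i^\alpha)_\alpha^\dagger$; and $v\overset{\tau}{\longrightarrow}q$ implies there is $u\overset{\tau}{\longrightarrow}p$ with $(p,q)\in(\approx_i^\alpha)_\alpha^\dagger$. A $k$-limited $\alpha$-bisimulation is any subset of $\approx_k^\alpha$. *)

theory Defs
  imports Complex_Main "HOL-Library.FuncSet"
begin

text \<open>Supremum in the complete lattice \<open>[0,1]\<close>, where \<open>\<Or>{} = 0\<close>; the real \<open>Sup {}\<close> is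
  unspecified.\<close>
definition unit_Sup :: "real set \<Rightarrow> real" where
  "unit_Sup A = (if A = {} then 0 else Sup A)"

locale left_continuous_tnorm =
  fixes tnorm :: "real \<Rightarrow> real \<Rightarrow> real"  (infixl "\<otimes>" 70)
  assumes closed: "\<lbrakk>r \<in> {0..1}; s \<in> {0..1}\<rbrakk> \<Longrightarrow> r \<otimes> s \<in> {0..1}"
    and commutative: "\<lbrakk>r \<in> {0..1}; s \<in> {0..1}\<rbrakk> \<Longrightarrow> r \<otimes> s = s \<otimes> r"
    and associative:
      "\<lbrakk>r \<in> {0..1}; s \<in> {0..1}; t \<in> {0..1}\<rbrakk> \<Longrightarrow> (r \<otimes> s) \<otimes> t = r \<otimes> (s \<otimes> t)"
    and increasing:
      "\<lbrakk>r \<in> {0..1}; r' \<in> {0..1}; s \<in> {0..1}; s' \<in> {0..1}; r \<le> r'; s \<le> s'\<rbrakk>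
        \<Longrightarrow> r \<otimes> s \<le> r' \<otimes> s'"
    and neutral: "r \<in> {0..1} \<Longrightarrow> r \<otimes> 1 = r"
    and left_continuous:
      "\<lbrakk>r \<in> {0..1}; A \<subseteq> {0..1}\<rbrakk> \<Longrightarrow> r \<otimes> unit_Sup A = unit_Sup ((\<lambda>s. r \<otimes> s) ` A)"

definition residuum :: "(real \<Rightarrow> real \<Rightarrow> real) \<Rightarrow> real \<Rightarrow> real \<Rightarrow> real" where
  "residuum tnorm t r = unit_Sup {s \<in> {0..1}. tnorm s t \<le> r}"

text \<open>Maps \<open>V \<rightarrow> [0,1]\<close>, represented as functions that are \<open>undefined\<close> outside \<open>V\<close>.\<close>
definition fuzzy_subsets :: "'v set \<Rightarrow> ('v \<Rightarrow> real) set" where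
  "fuzzy_subsets V = V \<rightarrow>\<^sub>E {0..1}"

text \<open>The value \<open>p(X)\<close>.\<close>
definition fuzzy_value :: "('v \<Rightarrow> real) \<Rightarrow> 'v set \<Rightarrow> real" where
  "fuzzy_value p X = unit_Sup (p ` X)"

locale nfts =
  fixes V :: "'v set" and \<Sigma> :: "'l set" and \<delta> :: "('v \<times> 'l \<times> ('v \<Rightarrow> real)) set"
  assumes finite_V: "finite V"
    and V_nonempty: "V \<noteq> {}"
    and transitions: "\<delta> \<subseteq> V \<times> \<Sigma> \<times> fuzzy_subsets V"

text \<open>The degree \<open>S(p,q,R)\<close> (with tilde); the set of successors of \<open>u\<close> under \<open>R\<close> is
  \<open>R `` {u}\<close>, the set of predecessors is \<open>R\<inverse> `` {u}\<close>.  The infimum is meant for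
  nonempty \<open>V\<close>.\<close>
definition lift_degree ::
  "(real \<Rightarrow> real \<Rightarrow> real) \<Rightarrow> 'v set \<Rightarrow> ('v \<Rightarrow> real) \<Rightarrow> ('v \<Rightarrow> real) \<Rightarrow> 'v rel \<Rightarrow> real" where
  "lift_degree tnorm V p q R =
    (INF u\<in>V. min (residuum tnorm (p u) (fuzzy_value q (R `` {u})))
                   (residuum tnorm (q u) (fuzzy_value p (R\<inverse> `` {u}))))"

definition lifted_rel ::
  "(real \<Rightarrow> real \<Rightarrow> real) \<Rightarrow> 'v set \<Rightarrow> real \<Rightarrow> 'v rel \<Rightarrow> ('v \<Rightarrow> real) rel" where
  "lifted_rel tnorm V \<alpha> R =
    {(p, q) \<in> fuzzy_subsets V \<times> fuzzy_subsets V. lift_degree tnorm V p q R \<ge> \<alpha>}"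

primrec limited_bisimilarity ::
  "(real \<Rightarrow> real \<Rightarrow> real) \<Rightarrow> 'v set \<Rightarrow> 'l set \<Rightarrow> ('v \<times> 'l \<times> ('v \<Rightarrow> real)) set
    \<Rightarrow> real \<Rightarrow> nat \<Rightarrow> 'v rel" where
  "limited_bisimilarity tnorm V \<Sigma> \<delta> \<alpha> 0 = V \<times> V"
| "limited_bisimilarity tnorm V \<Sigma> \<delta> \<alpha> (Suc i) =
    {(u, v) \<in> V \<times> V. \<forall>\<tau>\<in>\<Sigma>.
      (\<forall>p. (u, \<tau>, p) \<in> \<delta> \<longrightarrow>
        (\<exists>q. (v, \<tau>, q) \<in> \<delta> \<and>
          (p, q) \<in> lifted_rel tnorm V \<alpha> (limited_bisimilarity tnorm V \<Sigma> \<delta> \<alpha> i))) \<and>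
      (\<forall>q. (v, \<tau>, q) \<in> \<delta> \<longrightarrow>
        (\<exists>p. (u, \<tau>, p) \<in> \<delta> \<and>
          (p, q) \<in> lifted_rel tnorm V \<alpha> (limited_bisimilarity tnorm V \<Sigma> \<delta> \<alpha> i)))}"

definition limited_bisimulation ::
  "(real \<Rightarrow> real \<Rightarrow> real) \<Rightarrow> 'v set \<Rightarrow> 'l set \<Rightarrow> ('v \<times> 'l \<times> ('v \<Rightarrow> real)) set
    \<Rightarrow> nat \<Rightarrow> real \<Rightarrow> 'v rel \<Rightarrow> bool" where
  "limited_bisimulation tnorm V \<Sigma> \<delta> k \<alpha> R \<longleftrightarrow> R \<subseteq> limited_bisimilarity tnorm V \<Sigma> \<delta> \<alpha> k"

end

theory Submission
  imports Defs
begin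

text \<open>
  Because the \<open>t\<close>-norm is left-continuous, it is adjoint to its residuum:
  \<open>\<alpha> \<le> t \<rightarrow> r\<close> iff \<open>\<alpha> \<otimes> t \<le> r\<close>.  This removes both the residuum and the infimum from the
  lifted relation: \<open>(p, q)\<close> lies in the \<open>\<alpha>\<close>-lifting of \<open>R\<close> exactly if \<open>\<alpha> \<otimes> p(u)\<close> is at most
  the value of \<open>q\<close> on the successors of \<open>u\<close>, for all \<open>u\<close>, and the same holds with \<open>p\<close> and \<open>q\<close>
  exchanged and \<open>R\<close> reversed (lemma \<open>lifted_rel_iff\<close>).

  In this form the lifting is visibly monotone in \<open>R\<close>, antitone in \<open>\<alpha>\<close>, reflexive over the
  identity and compatible with converse.  It is also compatible with composition, at the price of
  multiplying the thresholds: \<open>(\<alpha>\<^sub>1 \<otimes> \<alpha>\<^sub>2) \<otimes> p(u) = \<alpha>\<^sub>2 \<otimes> (\<alpha>\<^sub>1 \<otimes> p(u))\<close> is at most \<open>\<alpha>\<^sub>2\<close> times a supremum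
  of values \<open>q(w)\<close>, and left-continuity moves \<open>\<alpha>\<^sub>2\<close> inside that supremum, where the second
  pair bounds it.  Each of these properties of the lifting passes to the limited bisimilarities by
  induction on the depth.  For bisimulations, which are just subsets of a bisimilarity, the claims
  on intersections and unions need only monotonicity in depth and threshold: an intersection lies
  in whichever relation attains the required maximum, and a union takes the smaller of both
  parameters.
\<close>

lemma unit_Sup_le_iff:
  assumes "A \<subseteq> {0..1}" and "0 \<le> r"
  shows "unit_Sup A \<le> r \<longleftrightarrow> (\<forall>a\<in>A. a \<le> r)"
proof (cases "A = {}")
  case False
  have "bdd_above A"
    using assms(1) by (meson atLeastAtMost_iff bdd_above.I subsetD)
  with False show ?thesis
    by (simp add: unit_Sup_def cSup_le_iff)
qed (use assms in \<open>simp add: unit_Sup_def\<close>)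

lemma unit_Sup_upper:
  assumes "A \<subseteq> {0..1}" and "a \<in> A"
  shows "a \<le> unit_Sup A"
proof -
  have "bdd_above A"
    using assms(1) by (meson atLeastAtMost_iff bdd_above.I subsetD)
  with assms(2) show ?thesis
    by (auto simp: unit_Sup_def intro: cSup_upper)
qed

lemma unit_Sup_in_unit:
  assumes "A \<subseteq> {0..1}"
  shows "unit_Sup A \<in> {0..1}"
proof -
  have "0 \<le> unit_Sup A"
  proof (cases "A = {}")
    case False
    then obtain a where "a \<in> A" by blast
    with assms have "0 \<le> a" by auto
    also have "a \<le> unit_Sup A" using assms \<open>a \<in> A\<close> by (rule unit_Sup_upper)
    finally show ?thesis .
  qed (simp add: unit_Sup_def)
  moreover have "unit_Sup A \<le> 1"
    using assms by (subst unit_Sup_le_iff) auto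
  ultimately show ?thesis by simp
qed

lemma fuzzy_subset_value: "\<lbrakk>p \<in> fuzzy_subsets V; u \<in> V\<rbrakk> \<Longrightarrow> p u \<in> {0..1}"
  unfolding fuzzy_subsets_def by (rule PiE_mem)

lemma fuzzy_subset_image: "\<lbrakk>p \<in> fuzzy_subsets V; X \<subseteq> V\<rbrakk> \<Longrightarrow> p ` X \<subseteq> {0..1}"
  using fuzzy_subset_value by fast

lemma fuzzy_value_in_unit: "\<lbrakk>p \<in> fuzzy_subsets V; X \<subseteq> V\<rbrakk> \<Longrightarrow> fuzzy_value p X \<in> {0..1}"
  unfolding fuzzy_value_def by (intro unit_Sup_in_unit fuzzy_subset_image)

lemma fuzzy_value_upper:
  "\<lbrakk>p \<in> fuzzy_subsets V; X \<subseteq> V; x \<in> X\<rbrakk> \<Longrightarrow> p x \<le> fuzzy_value p X"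
  unfolding fuzzy_value_def by (intro unit_Sup_upper fuzzy_subset_image) auto

lemma fuzzy_value_mono:
  assumes "p \<in> fuzzy_subsets V" and "X \<subseteq> Y" and "Y \<subseteq> V"
  shows "fuzzy_value p X \<le> fuzzy_value p Y"
proof -
  have "p x \<le> fuzzy_value p Y" if "x \<in> X" for x
    using fuzzy_value_upper[OF assms(1,3)] assms(2) that by blast
  moreover have "p ` X \<subseteq> {0..1}"
    using assms(2,3) by (intro fuzzy_subset_image[OF assms(1)]) auto
  moreover have "0 \<le> fuzzy_value p Y"
    using fuzzy_value_in_unit assms by fastforce
  ultimately show ?thesis
    by (subst fuzzy_value_def) (simp add: unit_Sup_le_iff)
qed

section \<open>Residuation\<close>

context left_continuous_tnorm
begin

lemma zero_absorbs:
  assumes "t \<in> {0..1}"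
  shows "0 \<otimes> t = 0"
  using closed[of 0 t] increasing[of 0 0 t 1] neutral[of 0] assms by simp

lemma tnorm_le_right:
  assumes "s \<in> {0..1}" "t \<in> {0..1}"
  shows "s \<otimes> t \<le> t"
  using increasing[of s 1 t t] commutative[of 1 t] neutral[of t] assms by simp

text \<open>
  Left-continuity makes the supremum that defines \<open>t \<rightarrow> r\<close> a maximum: multiplied by \<open>t\<close>,
  it is a supremum of numbers below \<open>r\<close>.
\<close>
lemma le_residuum_iff:
  assumes "a \<in> {0..1}" "t \<in> {0..1}" "r \<in> {0..1}"
  shows "a \<le> residuum (\<otimes>) t r \<longleftrightarrow> a \<otimes> t \<le> r"
proof
  let ?A = "{s \<in> {0..1}. s \<otimes> t \<le> r}"
  let ?m = "residuum (\<otimes>) t r"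
  have A: "?A \<subseteq> {0..1}" by blast
  have m: "?m \<in> {0..1}"
    unfolding residuum_def by (rule unit_Sup_in_unit[OF A])
  have "t \<otimes> ?m = unit_Sup ((\<lambda>s. t \<otimes> s) ` ?A)"
    unfolding residuum_def by (rule left_continuous[OF assms(2) A])
  also have "\<dots> \<le> r"
    using assms closed commutative by (subst unit_Sup_le_iff) auto
  finally have "?m \<otimes> t \<le> r"
    using commutative m assms(2) by simp
  moreover assume "a \<le> ?m"
  then have "a \<otimes> t \<le> ?m \<otimes> t"
    using assms m by (intro increasing) auto
  ultimately show "a \<otimes> t \<le> r" by simp
next
  assume "a \<otimes> t \<le> r"
  then show "a \<le> residuum (\<otimes>) t r"
    using assms unfolding residuum_def by (intro unit_Sup_upper) auto
qed

section \<open>The lifted relation\<close>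

text \<open>
  One of the two halves of the lifting.  Keeping it separate lets each property be proved once:
  the other half is the same condition for \<open>R\<inverse>\<close> and the exchanged distributions.
\<close>
definition dominates_along :: "'v set \<Rightarrow> real \<Rightarrow> 'v rel \<Rightarrow> ('v \<Rightarrow> real) \<Rightarrow> ('v \<Rightarrow> real) \<Rightarrow> bool" where
  "dominates_along V a R p q \<longleftrightarrow> (\<forall>u\<in>V. a \<otimes> p u \<le> fuzzy_value q (R `` {u}))"

lemma lifted_rel_iff:
  assumes "finite V" "V \<noteq> {}" "a \<in> {0..1}" "R \<subseteq> V \<times> V"
  shows "(p, q) \<in> lifted_rel (\<otimes>) V a R \<longleftrightarrow>
    p \<in> fuzzy_subsets V \<and> q \<in> fuzzy_subsets V \<and>
    dominates_along V a R p q \<and> dominates_along V a (R\<inverse>) q p"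
proof (cases "p \<in> fuzzy_subsets V \<and> q \<in> fuzzy_subsets V")
  case True
  have im: "R `` {u} \<subseteq> V" "R\<inverse> `` {u} \<subseteq> V" for u
    using assms(4) by auto
  have "a \<le> lift_degree (\<otimes>) V p q R \<longleftrightarrow>
      (\<forall>u\<in>V. a \<le> min (residuum (\<otimes>) (p u) (fuzzy_value q (R `` {u})))
                       (residuum (\<otimes>) (q u) (fuzzy_value p (R\<inverse> `` {u}))))"
    unfolding lift_degree_def using assms(1,2) by (intro le_cINF_iff) auto
  also have "\<dots> \<longleftrightarrow> (\<forall>u\<in>V. a \<otimes> p u \<le> fuzzy_value q (R `` {u}) \<and>
                               a \<otimes> q u \<le> fuzzy_value p (R\<inverse> `` {u}))"
    using True im assms(3)
    by (intro ball_cong refl) (simp only: min.bounded_iff le_residuum_iff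
        fuzzy_subset_value[of _ V] fuzzy_value_in_unit[of _ V])
  finally show ?thesis
    using True unfolding lifted_rel_def dominates_along_def by auto
qed (auto simp: lifted_rel_def)

lemma dominates_along_mono:
  assumes "dominates_along V a R p q" "p \<in> fuzzy_subsets V" "q \<in> fuzzy_subsets V"
    and "R \<subseteq> R'" "R' \<subseteq> V \<times> V" "b \<le> a" "a \<in> {0..1}" "b \<in> {0..1}"
  shows "dominates_along V b R' p q"
  unfolding dominates_along_def
proof
  fix u assume u: "u \<in> V"
  have "b \<otimes> p u \<le> a \<otimes> p u"
    using assms fuzzy_subset_value[OF assms(2) u] by (intro increasing) auto
  also have "\<dots> \<le> fuzzy_value q (R `` {u})"
    using assms(1) u unfolding dominates_along_def by blast
  also have "\<dots> \<le> fuzzy_value q (R' `` {u})"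
    using assms by (intro fuzzy_value_mono[of _ V]) auto
  finally show "b \<otimes> p u \<le> fuzzy_value q (R' `` {u})" .
qed

lemma dominates_along_refl:
  assumes "p \<in> fuzzy_subsets V" "Id_on V \<subseteq> R" "R \<subseteq> V \<times> V" "a \<in> {0..1}"
  shows "dominates_along V a R p p"
  unfolding dominates_along_def
proof
  fix u assume u: "u \<in> V"
  have "a \<otimes> p u \<le> p u"
    using assms(4) fuzzy_subset_value[OF assms(1) u] by (rule tnorm_le_right)
  also have "\<dots> \<le> fuzzy_value p (R `` {u})"
    using assms u by (intro fuzzy_value_upper[of _ V]) auto
  finally show "a \<otimes> p u \<le> fuzzy_value p (R `` {u})" .
qed

text \<open>
  The threshold \<open>a\<close> carries \<open>p u\<close> to a supremum over the successors \<open>w\<close> of \<open>u\<close>; multiplying by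
  \<open>b\<close> commutes with this supremum, and the second hypothesis bounds every \<open>b \<otimes> q w\<close>.
\<close>
lemma dominates_along_relcomp:
  assumes pq: "dominates_along V a R p q" and qs: "dominates_along V b S q s"
    and p: "p \<in> fuzzy_subsets V" and q: "q \<in> fuzzy_subsets V" and s: "s \<in> fuzzy_subsets V"
    and R: "R \<subseteq> V \<times> V" and S: "S \<subseteq> V \<times> V"
    and a: "a \<in> {0..1}" and b: "b \<in> {0..1}"
  shows "dominates_along V (a \<otimes> b) (R O S) p s"
  unfolding dominates_along_def
proof
  fix u assume u: "u \<in> V"
  let ?goal = "fuzzy_value s ((R O S) `` {u})"
  have pu: "p u \<in> {0..1}" using p u by (rule fuzzy_subset_value)
  have im: "R `` {u} \<subseteq> V" "(R O S) `` {u} \<subseteq> V" using R S by auto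
  have qim: "q ` (R `` {u}) \<subseteq> {0..1}" using q im(1) by (rule fuzzy_subset_image)
  have bound: "b \<otimes> q w \<le> ?goal" if w: "w \<in> R `` {u}" for w
  proof -
    have "b \<otimes> q w \<le> fuzzy_value s (S `` {w})"
      using qs w im unfolding dominates_along_def by blast
    also have "\<dots> \<le> ?goal"
      using w im by (intro fuzzy_value_mono[OF s]) auto
    finally show ?thesis .
  qed
  have "(a \<otimes> b) \<otimes> p u = b \<otimes> (a \<otimes> p u)"
    using a b pu commutative[of a b] associative[of b a "p u"] by simp
  also have "\<dots> \<le> b \<otimes> fuzzy_value q (R `` {u})"
    using pq a b pu u closed fuzzy_value_in_unit[OF q im(1)]
    unfolding dominates_along_def by (intro increasing) auto
  also have "\<dots> = unit_Sup ((\<lambda>r. b \<otimes> r) ` q ` (R `` {u}))"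
    unfolding fuzzy_value_def by (rule left_continuous[OF b qim])
  also have "\<dots> \<le> ?goal"
  proof (subst unit_Sup_le_iff)
    show "(\<lambda>r. b \<otimes> r) ` q ` (R `` {u}) \<subseteq> {0..1}"
      using closed[OF b] qim by blast
    show "0 \<le> ?goal"
      using fuzzy_value_in_unit[OF s im(2)] by simp
    show "\<forall>c\<in>(\<lambda>r. b \<otimes> r) ` q ` (R `` {u}). c \<le> ?goal"
      using bound by blast
  qed
  finally show "(a \<otimes> b) \<otimes> p u \<le> ?goal" .
qed

end

section \<open>Limited bisimilarities\<close>

lemma limited_bisimilarity_subset: "limited_bisimilarity tnorm V \<Sigma> \<delta> a k \<subseteq> V \<times> V"
  by (cases k) auto

locale tnorm_nfts = left_continuous_tnorm tnorm + nfts V \<Sigma> \<delta>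
  for tnorm :: "real \<Rightarrow> real \<Rightarrow> real"  (infixl "\<otimes>" 70)
    and V :: "'v set" and \<Sigma> :: "'l set" and \<delta> :: "('v \<times> 'l \<times> ('v \<Rightarrow> real)) set"
begin

abbreviation bisim :: "real \<Rightarrow> nat \<Rightarrow> 'v rel" where
  "bisim a k \<equiv> limited_bisimilarity (\<otimes>) V \<Sigma> \<delta> a k"

abbreviation lift :: "real \<Rightarrow> 'v rel \<Rightarrow> ('v \<Rightarrow> real) rel" where
  "lift a R \<equiv> lifted_rel (\<otimes>) V a R"

lemma target_fuzzy: "(u, \<tau>, p) \<in> \<delta> \<Longrightarrow> p \<in> fuzzy_subsets V"
  using transitions by blast

lemma lift_mono:
  assumes "(p, q) \<in> lift a R" "R \<subseteq> R'" "R' \<subseteq> V \<times> V" "b \<le> a" "a \<in> {0..1}" "b \<in> {0..1}"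
  shows "(p, q) \<in> lift b R'"
proof -
  have R: "R \<subseteq> V \<times> V" "R\<inverse> \<subseteq> R'\<inverse>" "R'\<inverse> \<subseteq> V \<times> V" using assms(2,3) by auto
  show ?thesis
    using assms R dominates_along_mono[of V a R p q R' b] dominates_along_mono[of V a "R\<inverse>" q p "R'\<inverse>" b]
    by (simp add: lifted_rel_iff[OF finite_V V_nonempty])
qed

lemma lift_refl:
  assumes "p \<in> fuzzy_subsets V" "Id_on V \<subseteq> R" "R \<subseteq> V \<times> V" "a \<in> {0..1}"
  shows "(p, p) \<in> lift a R"
proof -
  have "Id_on V \<subseteq> R\<inverse>" "R\<inverse> \<subseteq> V \<times> V" using assms(2,3) by auto
  then show ?thesis
    using assms by (simp add: lifted_rel_iff[OF finite_V V_nonempty] dominates_along_refl)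
qed

lemma lift_converse:
  assumes "(p, q) \<in> lift a R" "R \<subseteq> V \<times> V" "a \<in> {0..1}"
  shows "(q, p) \<in> lift a (R\<inverse>)"
proof -
  have "R\<inverse> \<subseteq> V \<times> V" using assms(2) by auto
  then show ?thesis
    using assms by (simp add: lifted_rel_iff[OF finite_V V_nonempty])
qed

lemma lift_relcomp:
  assumes "(p, q) \<in> lift a R" "(q, s) \<in> lift b S" "R \<subseteq> V \<times> V" "S \<subseteq> V \<times> V"
    and a: "a \<in> {0..1}" and b: "b \<in> {0..1}"
  shows "(p, s) \<in> lift (a \<otimes> b) (R O S)"
proof -
  have conv: "R\<inverse> \<subseteq> V \<times> V" "S\<inverse> \<subseteq> V \<times> V" and RS: "R O S \<subseteq> V \<times> V"
    using assms(3,4) by auto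
  note iff = lifted_rel_iff[OF finite_V V_nonempty]
  have 1: "p \<in> fuzzy_subsets V" "q \<in> fuzzy_subsets V"
      "dominates_along V a R p q" "dominates_along V a (R\<inverse>) q p"
    and 2: "s \<in> fuzzy_subsets V" "dominates_along V b S q s" "dominates_along V b (S\<inverse>) s q"
    using assms iff by simp_all
  have "dominates_along V (a \<otimes> b) (R O S) p s"
    using 1 2 assms by (intro dominates_along_relcomp)
  \<comment> \<open>Backwards, the pairs are traversed in the opposite order, so the factors come out exchanged.\<close>
  moreover have "dominates_along V (b \<otimes> a) (S\<inverse> O R\<inverse>) s p"
    using 1 2 conv a b by (intro dominates_along_relcomp)
  ultimately show ?thesis
    using 1 2 RS closed[OF a b] commutative[OF a b] by (simp add: iff converse_relcomp)
qed

text \<open>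
  Depth and threshold are handled by one induction, because a step lowers both depths by one and
  then needs the lifting to be monotone in the relation and antitone in the threshold at once.
  Inducting on the smaller depth makes the base case trivial: depth \<open>0\<close> relates all states.
\<close>
lemma bisim_mono:
  assumes "k2 \<le> k1" "b \<le> a" "a \<in> {0..1}" "b \<in> {0..1}"
  shows "bisim a k1 \<subseteq> bisim b k2"
  using assms(1)
proof (induction k2 arbitrary: k1)
  case 0
  show ?case using limited_bisimilarity_subset by simp
next
  case (Suc i)
  then obtain j where k1: "k1 = Suc j" and "i \<le> j" by (cases k1) auto
  have sub: "bisim a j \<subseteq> bisim b i" using Suc.IH \<open>i \<le> j\<close> by blast
  have lift: "(p, q) \<in> lift b (bisim b i)" if "(p, q) \<in> lift a (bisim a j)" for p q
    using that sub limited_bisimilarity_subset assms(2-4) by (rule lift_mono)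
  show ?case unfolding k1 by (auto dest!: lift) (meson lift)+
qed

lemma bisim_refl:
  assumes "a \<in> {0..1}"
  shows "Id_on V \<subseteq> bisim a k"
proof (induction k)
  case (Suc k)
  have "(p, p) \<in> lift a (bisim a k)" if "(u, \<tau>, p) \<in> \<delta>" for u \<tau> p
    using lift_refl[OF target_fuzzy[OF that] Suc limited_bisimilarity_subset assms] .
  then show ?case by fastforce
qed auto

lemma bisim_converse:
  assumes "a \<in> {0..1}"
  shows "(bisim a k)\<inverse> \<subseteq> bisim a k"
proof (induction k)
  case (Suc k)
  have "(q, p) \<in> lift a (bisim a k)" if "(p, q) \<in> lift a (bisim a k)" for p q
    using lift_mono[OF lift_converse[OF that]] Suc limited_bisimilarity_subset assms by blast
  then show ?case by fastforce
qed auto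

lemma bisim_forth:
  assumes "(u, v) \<in> bisim a (Suc k)" "(u, \<tau>, p) \<in> \<delta>"
  obtains q where "(v, \<tau>, q) \<in> \<delta>" "(p, q) \<in> lift a (bisim a k)"
proof -
  have "\<tau> \<in> \<Sigma>" using assms(2) transitions by blast
  with assms show thesis using that unfolding limited_bisimilarity.simps by blast
qed

lemma bisim_back:
  assumes "(u, v) \<in> bisim a (Suc k)" "(v, \<tau>, q) \<in> \<delta>"
  obtains p where "(u, \<tau>, p) \<in> \<delta>" "(p, q) \<in> lift a (bisim a k)"
proof -
  have "\<tau> \<in> \<Sigma>" using assms(2) transitions by blast
  with assms show thesis using that unfolding limited_bisimilarity.simps by blast
qed

lemma bisim_relcomp:
  assumes a: "a \<in> {0..1}" and b: "b \<in> {0..1}"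
  shows "bisim a k O bisim b k \<subseteq> bisim (a \<otimes> b) k"
proof (induction k)
  case (Suc k)
  note sub = limited_bisimilarity_subset
  let ?L = "lift (a \<otimes> b) (bisim (a \<otimes> b) k)"
  have comp: "(p, s) \<in> ?L"
    if "(p, q) \<in> lift a (bisim a k)" "(q, s) \<in> lift b (bisim b k)" for p q s
    using lift_mono[OF lift_relcomp[OF that sub sub a b] Suc sub order_refl] closed[OF a b] by blast
  show ?case
  proof (rule subrelI)
    fix u v assume "(u, v) \<in> bisim a (Suc k) O bisim b (Suc k)"
    then obtain w where uw: "(u, w) \<in> bisim a (Suc k)" and wv: "(w, v) \<in> bisim b (Suc k)"
      by blast
    have "\<exists>s. (v, \<tau>, s) \<in> \<delta> \<and> (p, s) \<in> ?L" if step: "(u, \<tau>, p) \<in> \<delta>" for \<tau> p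
    proof -
      obtain q where q: "(w, \<tau>, q) \<in> \<delta>" "(p, q) \<in> lift a (bisim a k)"
        using uw step by (rule bisim_forth)
      obtain s where "(v, \<tau>, s) \<in> \<delta>" "(q, s) \<in> lift b (bisim b k)"
        using wv q(1) by (rule bisim_forth)
      with q comp show ?thesis by blast
    qed
    moreover have "\<exists>p. (u, \<tau>, p) \<in> \<delta> \<and> (p, s) \<in> ?L" if step: "(v, \<tau>, s) \<in> \<delta>" for \<tau> s
    proof -
      obtain q where q: "(w, \<tau>, q) \<in> \<delta>" "(q, s) \<in> lift b (bisim b k)"
        using wv step by (rule bisim_back)
      obtain p where "(u, \<tau>, p) \<in> \<delta>" "(p, q) \<in> lift a (bisim a k)"
        using uw q(1) by (rule bisim_back)
      with q comp show ?thesis by blast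
    qed
    ultimately show "(u, v) \<in> bisim (a \<otimes> b) (Suc k)"
      using uw wv by simp
  qed
qed auto

end

section \<open>Closure properties of limited bisimulations\<close>

theorem proposition3p1:
  fixes tnorm :: "real \<Rightarrow> real \<Rightarrow> real"
    and V :: "'v set" and \<Sigma> :: "'l set" and \<delta> :: "('v \<times> 'l \<times> ('v \<Rightarrow> real)) set"
    and k k1 k2 :: nat and \<alpha> \<alpha>1 \<alpha>2 :: real
  assumes "left_continuous_tnorm tnorm"
    and "nfts V \<Sigma> \<delta>"
    and "\<alpha> \<in> {0..1}" and "\<alpha>1 \<in> {0..1}" and "\<alpha>2 \<in> {0..1}"
  shows "(k1 \<ge> k2 \<and> \<alpha>1 \<ge> \<alpha>2 \<longrightarrow>
            limited_bisimilarity tnorm V \<Sigma> \<delta> \<alpha>1 k1 \<subseteq> limited_bisimilarity tnorm V \<Sigma> \<delta> \<alpha>2 k2)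
    \<and> limited_bisimulation tnorm V \<Sigma> \<delta> k \<alpha> (Id_on V)
    \<and> (\<forall>R1 R2. limited_bisimulation tnorm V \<Sigma> \<delta> k1 \<alpha>1 R1
              \<and> limited_bisimulation tnorm V \<Sigma> \<delta> k2 \<alpha>2 R2 \<longrightarrow>
            limited_bisimulation tnorm V \<Sigma> \<delta> (min k1 k2) (max \<alpha>1 \<alpha>2) (R1 \<inter> R2)
          \<and> limited_bisimulation tnorm V \<Sigma> \<delta> (max k1 k2) (min \<alpha>1 \<alpha>2) (R1 \<inter> R2)
          \<and> limited_bisimulation tnorm V \<Sigma> \<delta> (min k1 k2) (min \<alpha>1 \<alpha>2) (R1 \<union> R2))
    \<and> (\<forall>R. limited_bisimulation tnorm V \<Sigma> \<delta> k \<alpha> R \<longrightarrow>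
            limited_bisimulation tnorm V \<Sigma> \<delta> k \<alpha> (R\<inverse>))
    \<and> (\<forall>R1 R2. limited_bisimulation tnorm V \<Sigma> \<delta> k1 \<alpha>1 R1
              \<and> limited_bisimulation tnorm V \<Sigma> \<delta> k2 \<alpha>2 R2 \<longrightarrow>
            limited_bisimulation tnorm V \<Sigma> \<delta> (min k1 k2) (tnorm \<alpha>1 \<alpha>2) (R1 O R2))"
proof -
  interpret tnorm_nfts tnorm V \<Sigma> \<delta>
    using assms(1,2) by (rule tnorm_nfts.intro)
  note sim = limited_bisimulation_def
  have mono: "limited_bisimulation tnorm V \<Sigma> \<delta> j b R"
    if "limited_bisimulation tnorm V \<Sigma> \<delta> i a R'" "R \<subseteq> R'" "j \<le> i" "b \<le> a"
      "a \<in> {0..1}" "b \<in> {0..1}" for i j a b R R'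
    using that bisim_mono[of j i b a] unfolding sim by blast
  have units: "max \<alpha>1 \<alpha>2 \<in> {0..1}" "min \<alpha>1 \<alpha>2 \<in> {0..1}"
    using assms(4,5) by auto
  have "limited_bisimulation tnorm V \<Sigma> \<delta> (min k1 k2) (max \<alpha>1 \<alpha>2) (R1 \<inter> R2)"
      "limited_bisimulation tnorm V \<Sigma> \<delta> (max k1 k2) (min \<alpha>1 \<alpha>2) (R1 \<inter> R2)"
      "limited_bisimulation tnorm V \<Sigma> \<delta> (min k1 k2) (min \<alpha>1 \<alpha>2) (R1 \<union> R2)"
      "limited_bisimulation tnorm V \<Sigma> \<delta> (min k1 k2) (tnorm \<alpha>1 \<alpha>2) (R1 O R2)"
    if R1: "limited_bisimulation tnorm V \<Sigma> \<delta> k1 \<alpha>1 R1"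
      and R2: "limited_bisimulation tnorm V \<Sigma> \<delta> k2 \<alpha>2 R2" for R1 R2
  proof -
    show "limited_bisimulation tnorm V \<Sigma> \<delta> (min k1 k2) (max \<alpha>1 \<alpha>2) (R1 \<inter> R2)"
    proof (cases "\<alpha>2 \<le> \<alpha>1")
      case True
      then show ?thesis using assms(4) by (intro mono[OF R1]) auto
    next
      case False
      then show ?thesis using assms(5) by (intro mono[OF R2]) auto
    qed
    show "limited_bisimulation tnorm V \<Sigma> \<delta> (max k1 k2) (min \<alpha>1 \<alpha>2) (R1 \<inter> R2)"
    proof (cases "k2 \<le> k1")
      case True
      then show ?thesis using assms(4) units by (intro mono[OF R1]) auto
    next
      case False
      then show ?thesis using assms(5) units by (intro mono[OF R2]) auto
    qed
    have "limited_bisimulation tnorm V \<Sigma> \<delta> (min k1 k2) (min \<alpha>1 \<alpha>2) R1"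
      using assms(4) units by (intro mono[OF R1]) auto
    moreover have "limited_bisimulation tnorm V \<Sigma> \<delta> (min k1 k2) (min \<alpha>1 \<alpha>2) R2"
      using assms(5) units by (intro mono[OF R2]) auto
    ultimately show "limited_bisimulation tnorm V \<Sigma> \<delta> (min k1 k2) (min \<alpha>1 \<alpha>2) (R1 \<union> R2)"
      unfolding sim by simp
    have "limited_bisimulation tnorm V \<Sigma> \<delta> (min k1 k2) \<alpha>1 R1"
      using assms(4) by (intro mono[OF R1]) auto
    moreover have "limited_bisimulation tnorm V \<Sigma> \<delta> (min k1 k2) \<alpha>2 R2"
      using assms(5) by (intro mono[OF R2]) auto
    ultimately show "limited_bisimulation tnorm V \<Sigma> \<delta> (min k1 k2) (tnorm \<alpha>1 \<alpha>2) (R1 O R2)"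
      unfolding sim using bisim_relcomp[OF assms(4,5)] by blast
  qed
  moreover have "limited_bisimulation tnorm V \<Sigma> \<delta> k \<alpha> (R\<inverse>)"
    if "limited_bisimulation tnorm V \<Sigma> \<delta> k \<alpha> R" for R
    using that bisim_converse[OF assms(3)] unfolding sim by blast
  moreover have "limited_bisimulation tnorm V \<Sigma> \<delta> k \<alpha> (Id_on V)"
    unfolding sim using assms(3) by (rule bisim_refl)
  moreover have "k1 \<ge> k2 \<and> \<alpha>1 \<ge> \<alpha>2 \<longrightarrow>
      limited_bisimilarity tnorm V \<Sigma> \<delta> \<alpha>1 k1 \<subseteq> limited_bisimilarity tnorm V \<Sigma> \<delta> \<alpha>2 k2"
    using bisim_mono assms(4,5) by blast
  ultimately show ?thesis by blast
qed

end
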